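(* For every positive integer $n$, the inverse of the $n\times n$ matrix $\mathcal B=\left[\frac{1}{\beta(i,j)}\right]_{i,j=1}^{n}$ has $(i,j)$th entry equal to $(-1)^{i+j}\sum_{k=1}^{n}\binom{k}{i}\binom{k}{j}\frac{1}{k}$ for all $1\le i,j\le n$.
   Context: Here $\beta(x,y)=\frac{\Gamma(x)\Gamma(y)}{\Gamma(x+y)}$ is the beta function, so $\frac{1}{\beta(i,j)}=\frac{(i+j-1)!}{(i-1)!(j-1)!}$ for positive integers $i,j$. The convention $\binom{k}{i}=0$ for $i>k$ is used. *)

theory Defs
  imports "HOL-Analysis.Gamma_Function" "Jordan_Normal_Form.Matrix"
begin

text \<open>Library matrices are indexed from 0, so the entry \<open>1 / \<beta>(i, j)\<close> with \<open>1 \<le> i, j \<le> n\<close>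
  is stored at position \<open>(i - 1, j - 1)\<close>.\<close>

definition recip_beta_mat :: "nat \<Rightarrow> real mat" where
  "recip_beta_mat n = mat n n (\<lambda>(i, j). 1 / Beta (real (i + 1)) (real (j + 1)))"

end

theory Submission
  imports Defs "Jordan_Normal_Form.Determinant"
begin

text \<open>
  Pascal's triangle diagonalises the matrix of reciprocal beta values.  Write
  \<open>L = [i choose k]\<close>, with \<open>1 \<le> i, k \<le> n\<close>, and \<open>D = diag (1, \<dots>, n)\<close>.  Since
  \<open>k (j choose k) = j (j - 1 choose k - 1)\<close>, Vandermonde's convolution gives
  \<open>\<Sum>k. k (i choose k) (j choose k) = j (i + j - 1 choose j) = 1 / \<beta>(i, j)\<close>
  (lemma \<open>recip_Beta_eq_sum_binomial\<close>), that is, the matrix equals \<open>L D L\<^sup>T\<close>.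

  The triangular factor is inverted by signs alone: binomial inversion
  (lemma \<open>binomial_orthogonality\<close>) says that
  \<open>M = [(-1) ^ (i + k) (i choose k)]\<close> is the inverse of \<open>L\<close>.  So the inverse of
  \<open>L D L\<^sup>T\<close> is \<open>M\<^sup>T D\<inverse> M\<close>, and its \<open>(i, j)\<close> entry is
  \<open>\<Sum>k. (-1) ^ (k + i) (k choose i) (1 / k) (-1) ^ (k + j) (k choose j)\<close>, in which the
  two occurrences of \<open>(-1) ^ k\<close> cancel.
\<close>

text \<open>
  For \<open>j \<le> k \<le> i\<close> one has
  \<open>(i choose k) (k choose j) = (i choose j) (i - j choose k - j)\<close>; all other terms vanish.
  What remains is \<open>(i choose j)\<close> times the expansion of \<open>(1 - 1) ^ (i - j)\<close>.
\<close>

lemma binomial_orthogonality: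
  assumes "i \<le> n"
  shows "(\<Sum>k\<le>n. (-1) ^ (k + j) * of_nat (i choose k) * of_nat (k choose j))
           = (if i = j then 1 else 0 :: 'a :: comm_ring_1)"
proof (cases "j \<le> i")
  case False
  then have "(i choose k) * (k choose j) = 0" for k
    by (cases "k \<le> i") auto
  then have "of_nat (i choose k) * of_nat (k choose j) = (0 :: 'a)" for k
    by (metis of_nat_0 of_nat_mult)
  then show ?thesis
    using False by (auto simp: mult.assoc)
next
  case True
  let ?f = "\<lambda>k. (-1) ^ (k + j) * of_nat (i choose k) * of_nat (k choose j) :: 'a"
  have "sum ?f {..n} = sum ?f {j..i}"
    by (rule sum.mono_neutral_right) (use assms in \<open>auto simp: not_le binomial_eq_0\<close>)
  also have "\<dots> = (\<Sum>m\<le>i - j. ?f (m + j))"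
    by (rule sum.reindex_bij_witness[of _ "\<lambda>m. m + j" "\<lambda>k. k - j"]) (use True in auto)
  also have "\<dots> = (\<Sum>m\<le>i - j. of_nat (i choose j) * ((-1) ^ m * of_nat (i - j choose m)))"
  proof (rule sum.cong[OF refl])
    fix m assume "m \<in> {..i - j}"
    then have "(i choose (m + j)) * ((m + j) choose j) = (i choose j) * (i - j choose m)"
      using choose_mult[of j "m + j" i] True by simp
    then have "of_nat (i choose (m + j)) * of_nat ((m + j) choose j)
                 = (of_nat (i choose j) * of_nat (i - j choose m) :: 'a)"
      by (metis of_nat_mult)
    then show "?f (m + j) = of_nat (i choose j) * ((-1) ^ m * of_nat (i - j choose m))"
      by (simp add: power_add mult.assoc mult.left_commute flip: power_mult_distrib)
  qed
  also have "\<dots> = of_nat (i choose j) * (\<Sum>m\<le>i - j. (-1) ^ m * of_nat (i - j choose m))"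
    by (simp add: sum_distrib_left)
  also have "\<dots> = (if i = j then 1 else 0)"
    using True choose_alternating_sum[of "i - j", where 'a = 'a] by auto
  finally show ?thesis .
qed

text \<open>
  The same relation in the index convention of library matrices.  The summand dropped by
  the shift is the one at \<open>k = 0\<close>, and \<open>0 choose Suc j\<close> vanishes.
\<close>

lemma binomial_orthogonality_Suc:
  assumes "i < n"
  shows "(\<Sum>k<n. (-1) ^ (k + j) * of_nat (Suc i choose Suc k) * of_nat (Suc k choose Suc j))
           = (if i = j then 1 else 0 :: 'a :: comm_ring_1)"
  using binomial_orthogonality[of "Suc i" n "Suc j", where 'a = 'a] assms
  by (simp add: sum.atMost_shift del: binomial_Suc_Suc)

text \<open>
  Absorbing the factor \<open>Suc k\<close> into the second coefficient and reflecting the first one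
  turns the sum into a Vandermonde convolution.
\<close>

lemma sum_mult_binomial_binomial:
  assumes "i < n"
  shows "(\<Sum>k<n. Suc k * (Suc i choose Suc k) * (Suc j choose Suc k))
           = Suc j * (Suc (i + j) choose Suc j)"
proof -
  have "(\<Sum>k<n. Suc k * (Suc i choose Suc k) * (Suc j choose Suc k))
          = (\<Sum>k\<le>i. Suc k * (Suc i choose Suc k) * (Suc j choose Suc k))"
    by (rule sum.mono_neutral_right) (use assms in auto)
  also have "\<dots> = (\<Sum>k\<le>i. Suc j * ((j choose k) * (Suc i choose (i - k))))"
  proof (rule sum.cong[OF refl])
    fix k assume "k \<in> {..i}"
    then have "Suc i choose Suc k = Suc i choose (i - k)"
      using binomial_symmetric[of "Suc k" "Suc i"] by simp
    then show "Suc k * (Suc i choose Suc k) * (Suc j choose Suc k)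
                 = Suc j * ((j choose k) * (Suc i choose (i - k)))"
      using Suc_times_binomial_eq[of j k] by (simp del: binomial_Suc_Suc mult_Suc add: mult_ac)
  qed
  also have "\<dots> = Suc j * ((j + Suc i) choose i)"
    by (simp only: sum_distrib_left[symmetric] vandermonde)
  also have "(j + Suc i) choose i = Suc (i + j) choose Suc j"
    using binomial_symmetric[of i "j + Suc i"] by (simp add: add.commute)
  finally show ?thesis .
qed

lemma recip_Beta_eq_sum_binomial:
  assumes "i < n"
  shows "1 / Beta (real (Suc i)) (real (Suc j))
           = (\<Sum>k<n. real (Suc k) * real (Suc i choose Suc k) * real (Suc j choose Suc k))"
proof -
  have G: "Gamma (real (Suc m)) = fact m" for m
    using Gamma_fact[of m, where 'a = real] by (simp add: add.commute)
  have "Beta (real (Suc i)) (real (Suc j)) = fact i * fact j / fact (Suc (i + j))"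
    unfolding Beta_def G using G[of "Suc (i + j)"] by (simp add: algebra_simps)
  moreover have "real (Suc (i + j) choose Suc j) = fact (Suc (i + j)) / (fact (Suc j) * fact i)"
    using binomial_fact[of "Suc j" "Suc (i + j)", where 'a = real] by simp
  moreover have "fact (Suc j) = real (Suc j) * fact j"
    by simp
  ultimately have "1 / Beta (real (Suc i)) (real (Suc j))
                     = real (Suc j * (Suc (i + j) choose Suc j))"
    by (simp add: mult_ac del: binomial_Suc_Suc fact_Suc of_nat_Suc mult_Suc)
  also have "\<dots> = (\<Sum>k<n. real (Suc k) * real (Suc i choose Suc k) * real (Suc j choose Suc k))"
    unfolding sum_mult_binomial_binomial[OF assms, of j, symmetric] of_nat_sum of_nat_mult ..
  finally show ?thesis .
qed

theorem corollary2p6: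
  fixes n :: nat
  assumes "n \<ge> 1"
  shows "\<exists>C \<in> carrier_mat n n.
           inverts_mat (recip_beta_mat n) C \<and> inverts_mat C (recip_beta_mat n) \<and>
           (\<forall>i \<in> {1..n}. \<forall>j \<in> {1..n}.
              C $$ (i - 1, j - 1) =
                (-1) ^ (i + j) * (\<Sum>k = 1..n. real (k choose i) * real (k choose j) * (1 / real k)))"
proof -
  \<comment> \<open>In the notation \<open>L D L\<^sup>T\<close> and \<open>M\<^sup>T D\<inverse> M\<close>, the matrix \<open>U\<close> is \<open>D L\<^sup>T\<close> and \<open>V\<close> is \<open>M\<^sup>T D\<inverse>\<close>.\<close>
  define L where "L = mat n n (\<lambda>(i, k). real (Suc i choose Suc k))"
  define U where "U = mat n n (\<lambda>(k, j). real (Suc k) * real (Suc j choose Suc k))"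
  define V where "V = mat n n (\<lambda>(i, k). (-1) ^ (i + k) * real (Suc k choose Suc i) / real (Suc k))"
  define M where "M = mat n n (\<lambda>(k, j). (-1) ^ (k + j) * real (Suc k choose Suc j))"
  note defs = L_def U_def V_def M_def
  have carr [simp]: "L \<in> carrier_mat n n" "U \<in> carrier_mat n n"
      "V \<in> carrier_mat n n" "M \<in> carrier_mat n n"
    by (simp_all add: defs)
  have B_eq: "recip_beta_mat n = L * U"
    by (rule eq_matI)
       (simp_all add: recip_beta_mat_def L_def U_def scalar_prod_def recip_Beta_eq_sum_binomial
         lessThan_atLeast0 mult_ac del: binomial_Suc_Suc of_nat_Suc)
  have LM: "L * M = 1\<^sub>m n"
  proof (rule eq_matI)
    fix i j assume "i < dim_row (1\<^sub>m n :: real mat)" "j < dim_col (1\<^sub>m n :: real mat)"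
    then have ij: "i < n" "j < n" by simp_all
    then show "(L * M) $$ (i, j) = 1\<^sub>m n $$ (i, j)"
      using binomial_orthogonality_Suc[of i n j, where 'a = real]
      by (simp add: L_def M_def scalar_prod_def lessThan_atLeast0 mult_ac
            del: binomial_Suc_Suc of_nat_Suc)
  qed (simp_all add: defs)
  have UV: "U * V = 1\<^sub>m n"
  proof (rule eq_matI)
    fix i j assume "i < dim_row (1\<^sub>m n :: real mat)" "j < dim_col (1\<^sub>m n :: real mat)"
    then have ij: "i < n" "j < n" by simp_all
    then have "(U * V) $$ (i, j) = real (Suc i) / real (Suc j) *
        (\<Sum>k<n. (-1) ^ (k + i) * real (Suc j choose Suc k) * real (Suc k choose Suc i))
        * (-1) ^ (i + j)"
      by (simp add: U_def V_def scalar_prod_def lessThan_atLeast0 sum_distrib_left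
            sum_distrib_right power_add mult_ac del: binomial_Suc_Suc of_nat_Suc)
    also have "\<dots> = 1\<^sub>m n $$ (i, j)"
      unfolding binomial_orthogonality_Suc[OF ij(2)] using ij by auto
    finally show "(U * V) $$ (i, j) = 1\<^sub>m n $$ (i, j)" .
  qed (simp_all add: defs)
  have C_carr: "V * M \<in> carrier_mat n n"
    by (rule mult_carrier_mat[OF carr(3,4)])
  have "recip_beta_mat n * (V * M) = L * (U * (V * M))"
    unfolding B_eq by (rule assoc_mult_mat[OF carr(1,2) C_carr])
  also have "U * (V * M) = U * V * M"
    by (rule assoc_mult_mat[OF carr(2-4), symmetric])
  finally have BC: "recip_beta_mat n * (V * M) = 1\<^sub>m n"
    by (simp add: UV LM left_mult_one_mat[OF carr(4)])
  have B_carr: "recip_beta_mat n \<in> carrier_mat n n"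
    by (simp add: recip_beta_mat_def)
  have CB: "V * M * recip_beta_mat n = 1\<^sub>m n"
    by (rule mat_mult_left_right_inverse[OF B_carr C_carr BC])
  have entry: "(V * M) $$ (i - 1, j - 1)
      = (-1) ^ (i + j) * (\<Sum>k = 1..n. real (k choose i) * real (k choose j) * (1 / real k))"
    if "i \<in> {1..n}" "j \<in> {1..n}" for i j
  proof -
    from that obtain i' j' where ij: "i = Suc i'" "j = Suc j'" "i' < n" "j' < n"
      by (metis Suc_le_D Suc_le_eq atLeastAtMost_iff One_nat_def)
    have "(V * M) $$ (i', j') = (\<Sum>k<n. (-1) ^ (i + j) *
            (real (Suc k choose i) * real (Suc k choose j) * (1 / real (Suc k))))"
      using ij by (simp add: V_def M_def scalar_prod_def lessThan_atLeast0 power_add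
          mult_ac del: binomial_Suc_Suc of_nat_Suc)
    also have "\<dots> = (\<Sum>k = 1..n. (-1) ^ (i + j) *
            (real (k choose i) * real (k choose j) * (1 / real k)))"
      by (rule sum.reindex_bij_witness[of _ "\<lambda>k. k - 1" Suc]) auto
    finally show ?thesis
      by (simp add: ij sum_distrib_left del: binomial_Suc_Suc of_nat_Suc)
  qed
  show ?thesis
    using C_carr B_carr BC CB entry unfolding inverts_mat_def
    by (intro bexI[of _ "V * M"]) auto
qed

end
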